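(* Let $H=(H^\bullet,H^\times)$ be a hypergraph and $\mathcal{H}$ the set of its subhypergraphs, ordered by $\subseteq$. For $X=(X^\bullet,X^\times)\in\mathcal{H}$ define $[\delta,\Delta](X)=(\delta(X^\bullet),\Delta(X^\times))$ and $[\epsilon,\varepsilon](X)=(\epsilon(X^\bullet),\varepsilon(X^\times))$. Then $[\delta,\Delta]$ and $[\epsilon,\varepsilon]$ map $\mathcal{H}$ into $\mathcal{H}$, and they are respectively a dilation and an erosion on the lattice $(\mathcal{H},\subseteq)$.
   Context: A hypergraph is a pair $H=(H^\bullet,H^\times)$ where $H^\bullet$ is a set of vertices and $H^\times=(e_i)_{i\in I}$ is a family of hyperedges indexed by a finite set $I$, each hyperedge $e$ having a vertex set $v(e)\subseteq H^\bullet$. Subsets of $H^\times$ are subfamilies $X^\times=(e_j)_{j\in J}$, $J\subseteq I$. A subhypergraph of $H$ is a pair $X=(X^\bullet,X^\times)$ with $X^\bullet\subseteq H^\bullet$, $X^\times\subseteq H^\times$ and $v(e)\subseteq X^\bullet$ for every $e\in X^\times$; $X\subseteq Y$ means $X^\bullet\subseteq Y^\bullet$ and $X^\times\subseteq Y^\times$. Operators: $\delta^\bullet(X^\times)=\bigcup_{j\in J}v(e_j)$; $\epsilon^\bullet(X^\times)=\bigcap_{i\in I\setminus J}\overline{v(e_i)}$ (complement in $H^\bullet$); $\epsilon^\times(X^\bullet)=\{e_i, i\in I\mid v(e_i)\subseteq X^\bullet\}$; $\delta^\times(X^\bullet)=\{e_i, i\in I\mid v(e_i)\cap X^\bullet\neq\emptyset\}$;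 $\delta=\delta^\bullet\circ\delta^\times$, $\epsilon=\epsilon^\bullet\circ\epsilon^\times$ (on subsets of $H^\bullet$); $\Delta=\delta^\times\circ\delta^\bullet$, $\varepsilon=\epsilon^\times\circ\epsilon^\bullet$ (on subsets of $H^\times$). A dilation on a lattice is an operator commuting with arbitrary suprema (hence preserving the least element); an erosion commutes with arbitrary infima (hence preserves the greatest element). *)

theory Defs
  imports "HOL-Algebra.Complete_Lattice"
begin

text \<open>A family of hyperedges is given by its index set together with the map sending an index to
  the vertex set of the corresponding hyperedge. Distinct indices may carry the same vertex set,
  and vertex sets may be empty. Subfamilies are identified with subsets of the index set.\<close>

record ('v, 'i) hypergraph =
  verts :: "'v set"
  edge_index :: "'i set"
  vset :: "'i \<Rightarrow> 'v set"

definition is_hypergraph :: "('v, 'i) hypergraph \<Rightarrow> bool" where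
  "is_hypergraph H \<longleftrightarrow>
     finite (edge_index H) \<and> (\<forall>i\<in>edge_index H. vset H i \<subseteq> verts H)"

definition subhypergraphs :: "('v, 'i) hypergraph \<Rightarrow> ('v set \<times> 'i set) set" where
  "subhypergraphs H =
     {(X, J). X \<subseteq> verts H \<and> J \<subseteq> edge_index H \<and> (\<forall>j\<in>J. vset H j \<subseteq> X)}"

definition subhyp_le :: "'v set \<times> 'i set \<Rightarrow> 'v set \<times> 'i set \<Rightarrow> bool" where
  "subhyp_le X Y \<longleftrightarrow> fst X \<subseteq> fst Y \<and> snd X \<subseteq> snd Y"

definition subhyp_order :: "('v, 'i) hypergraph \<Rightarrow> ('v set \<times> 'i set) gorder" where
  "subhyp_order H = \<lparr>carrier = subhypergraphs H, eq = (=), le = subhyp_le\<rparr>"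

definition dil_vert :: "('v, 'i) hypergraph \<Rightarrow> 'i set \<Rightarrow> 'v set" where
  "dil_vert H J = (\<Union>j\<in>J. vset H j)"

text \<open>The outer intersection with the vertex set makes the empty intersection (no hyperedge
  outside \<open>J\<close>) equal to the whole vertex set instead of \<open>UNIV\<close>.\<close>

definition ero_vert :: "('v, 'i) hypergraph \<Rightarrow> 'i set \<Rightarrow> 'v set" where
  "ero_vert H J = verts H \<inter> (\<Inter>i\<in>edge_index H - J. verts H - vset H i)"

definition ero_edge :: "('v, 'i) hypergraph \<Rightarrow> 'v set \<Rightarrow> 'i set" where
  "ero_edge H X = {i \<in> edge_index H. vset H i \<subseteq> X}"

definition dil_edge :: "('v, 'i) hypergraph \<Rightarrow> 'v set \<Rightarrow> 'i set" where
  "dil_edge H X = {i \<in> edge_index H. vset H i \<inter> X \<noteq> {}}"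

definition vert_dilation :: "('v, 'i) hypergraph \<Rightarrow> 'v set \<Rightarrow> 'v set" where
  "vert_dilation H = dil_vert H \<circ> dil_edge H"

definition vert_erosion :: "('v, 'i) hypergraph \<Rightarrow> 'v set \<Rightarrow> 'v set" where
  "vert_erosion H = ero_vert H \<circ> ero_edge H"

definition edge_dilation :: "('v, 'i) hypergraph \<Rightarrow> 'i set \<Rightarrow> 'i set" where
  "edge_dilation H = dil_edge H \<circ> dil_vert H"

definition edge_erosion :: "('v, 'i) hypergraph \<Rightarrow> 'i set \<Rightarrow> 'i set" where
  "edge_erosion H = ero_edge H \<circ> ero_vert H"

definition hyp_dilation :: "('v, 'i) hypergraph \<Rightarrow> 'v set \<times> 'i set \<Rightarrow> 'v set \<times> 'i set" where
  "hyp_dilation H X = (vert_dilation H (fst X), edge_dilation H (snd X))"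

definition hyp_erosion :: "('v, 'i) hypergraph \<Rightarrow> 'v set \<times> 'i set \<Rightarrow> 'v set \<times> 'i set" where
  "hyp_erosion H X = (vert_erosion H (fst X), edge_erosion H (snd X))"

text \<open>The families \<open>A\<close> below may be empty or infinite. The library supremum and infimum are
  meaningful for all of them only if \<open>L\<close> is a complete lattice; the empty family then yields
  preservation of the least (greatest) element.\<close>

definition is_dilation :: "('a, 'b) gorder_scheme \<Rightarrow> ('a \<Rightarrow> 'a) \<Rightarrow> bool" where
  "is_dilation L f \<longleftrightarrow> f \<in> carrier L \<rightarrow> carrier L \<and>
     (\<forall>A. A \<subseteq> carrier L \<longrightarrow> f (\<Squnion>\<^bsub>L\<^esub> A) = \<Squnion>\<^bsub>L\<^esub> (f ` A))"

definition is_erosion :: "('a, 'b) gorder_scheme \<Rightarrow> ('a \<Rightarrow> 'a) \<Rightarrow> bool" where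
  "is_erosion L f \<longleftrightarrow> f \<in> carrier L \<rightarrow> carrier L \<and>
     (\<forall>A. A \<subseteq> carrier L \<longrightarrow> f (\<Sqinter>\<^bsub>L\<^esub> A) = \<Sqinter>\<^bsub>L\<^esub> (f ` A))"

end

theory Submission
  imports Defs
begin

text \<open>Suprema and infima of subhypergraphs are computed componentwise, the empty infimum being
  the whole hypergraph. Hence the operators preserve them as soon as the vertex and edge
  components do. That the images are again subhypergraphs rests on
  \<open>dil_vert H J \<subseteq> X\<close> and \<open>J \<subseteq> ero_edge H X\<close> for a subhypergraph \<open>(X, J)\<close>, to which the
  increasing maps \<open>dil_edge H\<close> and \<open>ero_vert H\<close> are applied.\<close>

definition subhyp_Sup :: "('v set \<times> 'i set) set \<Rightarrow> 'v set \<times> 'i set" where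
  "subhyp_Sup A = (\<Union>(fst ` A), \<Union>(snd ` A))"

text \<open>The outer intersections prevent the empty family from giving \<open>UNIV\<close> in both
  components.\<close>

definition subhyp_Inf ::
    "('v, 'i) hypergraph \<Rightarrow> ('v set \<times> 'i set) set \<Rightarrow> 'v set \<times> 'i set" where
  "subhyp_Inf H A = (verts H \<inter> \<Inter>(fst ` A), edge_index H \<inter> \<Inter>(snd ` A))"

lemma carrier_subhyp_order [simp]: "carrier (subhyp_order H) = subhypergraphs H"
  by (simp add: subhyp_order_def)

lemma le_subhyp_order [simp]: "le (subhyp_order H) = subhyp_le"
  by (simp add: subhyp_order_def)

lemma partial_order_subhyp_order: "partial_order (subhyp_order H)"
  by unfold_locales (auto simp: subhyp_order_def subhyp_le_def)

lemma mem_subhypergraphs_iff: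
  "X \<in> subhypergraphs H \<longleftrightarrow>
    fst X \<subseteq> verts H \<and> snd X \<subseteq> edge_index H \<and> (\<forall>j\<in>snd X. vset H j \<subseteq> fst X)"
  by (cases X) (simp add: subhypergraphs_def)

lemma subhyp_Sup_closed:
  assumes "A \<subseteq> subhypergraphs H"
  shows "subhyp_Sup A \<in> subhypergraphs H"
proof -
  have A: "fst X \<subseteq> verts H \<and> snd X \<subseteq> edge_index H \<and> (\<forall>j\<in>snd X. vset H j \<subseteq> fst X)"
    if "X \<in> A" for X
    using subsetD[OF assms that] unfolding mem_subhypergraphs_iff .
  have "\<Union>(fst ` A) \<subseteq> verts H" and "\<Union>(snd ` A) \<subseteq> edge_index H"
    using A by (simp_all add: UN_subset_iff)
  moreover have "vset H j \<subseteq> \<Union>(fst ` A)" if "X \<in> A" and "j \<in> snd X" for X j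
    using A[OF that(1)] that by (meson UN_upper order_trans)
  ultimately show ?thesis
    unfolding mem_subhypergraphs_iff subhyp_Sup_def fst_conv snd_conv by (meson UN_E)
qed

text \<open>For empty \<open>A\<close> this says that the whole hypergraph is a subhypergraph of
  itself, which is where \<open>is_hypergraph H\<close> enters.\<close>

lemma subhyp_Inf_closed:
  assumes "is_hypergraph H" and "A \<subseteq> subhypergraphs H"
  shows "subhyp_Inf H A \<in> subhypergraphs H"
proof -
  have "vset H j \<subseteq> verts H \<inter> \<Inter>(fst ` A)" if j: "j \<in> edge_index H \<inter> \<Inter>(snd ` A)" for j
  proof -
    have "vset H j \<subseteq> fst X" if "X \<in> A" for X
      using subsetD[OF assms(2) that] j that unfolding mem_subhypergraphs_iff by blast
    then show ?thesis
      using assms(1) j unfolding is_hypergraph_def by (simp add: INT_greatest)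
  qed
  then show ?thesis
    unfolding mem_subhypergraphs_iff subhyp_Inf_def fst_conv snd_conv
    by (intro conjI ballI Int_lower1)
qed

lemma least_subhyp_Sup:
  assumes "A \<subseteq> subhypergraphs H"
  shows "least (subhyp_order H) (subhyp_Sup A) (Upper (subhyp_order H) A)"
proof (rule least_UpperI)
  fix X assume "X \<in> A"
  then show "X \<sqsubseteq>\<^bsub>subhyp_order H\<^esub> subhyp_Sup A"
    by (auto simp: subhyp_Sup_def subhyp_le_def)
next
  fix Y assume "Y \<in> Upper (subhyp_order H) A"
  then have "subhyp_le X Y" if "X \<in> A" for X
    using assms that unfolding Upper_def carrier_subhyp_order le_subhyp_order by blast
  then show "subhyp_Sup A \<sqsubseteq>\<^bsub>subhyp_order H\<^esub> Y"
    by (force simp: subhyp_Sup_def subhyp_le_def)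
qed (simp_all add: assms subhyp_Sup_closed)

lemma greatest_subhyp_Inf:
  assumes "is_hypergraph H" and "A \<subseteq> subhypergraphs H"
  shows "greatest (subhyp_order H) (subhyp_Inf H A) (Lower (subhyp_order H) A)"
proof (rule greatest_LowerI)
  fix X assume "X \<in> A"
  then show "subhyp_Inf H A \<sqsubseteq>\<^bsub>subhyp_order H\<^esub> X"
    by (auto simp: subhyp_Inf_def subhyp_le_def)
next
  fix Y assume Y: "Y \<in> Lower (subhyp_order H) A"
  then have "subhyp_le Y X" if "X \<in> A" for X
    using assms that unfolding Lower_def carrier_subhyp_order le_subhyp_order by blast
  \<comment> \<open>Bounds \<open>Y\<close> by \<open>verts H\<close> and
    \<open>edge_index H\<close>; for empty \<open>A\<close> no member of the family does so.\<close>
  moreover have "Y \<in> subhypergraphs H"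
    using Y by (simp add: Lower_def)
  ultimately show "Y \<sqsubseteq>\<^bsub>subhyp_order H\<^esub> subhyp_Inf H A"
    by (force simp: subhyp_Inf_def subhyp_le_def subhypergraphs_def)
qed (simp_all add: assms subhyp_Inf_closed)

lemma complete_lattice_subhyp_order:
  assumes "is_hypergraph H"
  shows "complete_lattice (subhyp_order H)"
proof -
  interpret partial_order "subhyp_order H"
    by (rule partial_order_subhyp_order)
  show ?thesis
    by unfold_locales (metis carrier_subhyp_order least_subhyp_Sup,
      metis carrier_subhyp_order greatest_subhyp_Inf[OF assms])
qed

text \<open>The library supremum is a Hilbert choice among least upper bounds. By antisymmetry there
  is only one, so the choice must return the explicit one.\<close>

lemma sup_subhyp_order:
  assumes "A \<subseteq> subhypergraphs H"
  shows "\<Squnion>\<^bsub>subhyp_order H\<^esub> A = subhyp_Sup A"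
proof -
  interpret partial_order "subhyp_order H"
    by (rule partial_order_subhyp_order)
  show ?thesis
    unfolding sup_def using least_subhyp_Sup[OF assms] least_unique by (metis someI)
qed

lemma inf_subhyp_order:
  assumes "is_hypergraph H" and "A \<subseteq> subhypergraphs H"
  shows "\<Sqinter>\<^bsub>subhyp_order H\<^esub> A = subhyp_Inf H A"
proof -
  interpret partial_order "subhyp_order H"
    by (rule partial_order_subhyp_order)
  show ?thesis
    unfolding inf_def using greatest_subhyp_Inf[OF assms] greatest_unique by (metis someI)
qed

lemma hyp_dilation_subhypergraphs:
  assumes "is_hypergraph H"
  shows "hyp_dilation H \<in> subhypergraphs H \<rightarrow> subhypergraphs H"
proof
  fix Z assume Z: "Z \<in> subhypergraphs H"
  obtain X J where [simp]: "Z = (X, J)"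
    by (cases Z)
  have "dil_vert H J \<subseteq> X"
    using Z by (auto simp: subhypergraphs_def dil_vert_def)
  then have "edge_dilation H J \<subseteq> dil_edge H X"
    by (auto simp: edge_dilation_def dil_edge_def)
  \<comment> \<open>Such a \<open>j\<close> lies in \<open>dil_edge H X\<close>, so
    \<open>vset H j\<close> is one of the sets united in \<open>vert_dilation H X\<close>.\<close>
  then have "vset H j \<subseteq> vert_dilation H X" if "j \<in> edge_dilation H J" for j
    using that by (auto simp: vert_dilation_def dil_vert_def)
  moreover have "vert_dilation H X \<subseteq> verts H"
    using assms by (auto simp: vert_dilation_def dil_vert_def dil_edge_def is_hypergraph_def)
  moreover have "edge_dilation H J \<subseteq> edge_index H"
    by (auto simp: edge_dilation_def dil_edge_def)
  ultimately show "hyp_dilation H Z \<in> subhypergraphs H"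
    by (simp add: hyp_dilation_def subhypergraphs_def)
qed

lemma hyp_erosion_subhypergraphs:
  "hyp_erosion H \<in> subhypergraphs H \<rightarrow> subhypergraphs H"
proof
  fix Z assume Z: "Z \<in> subhypergraphs H"
  obtain X J where [simp]: "Z = (X, J)"
    by (cases Z)
  have "J \<subseteq> ero_edge H X"
    using Z by (auto simp: subhypergraphs_def ero_edge_def)
  then have "ero_vert H J \<subseteq> vert_erosion H X"
    by (auto simp: vert_erosion_def ero_vert_def)
  \<comment> \<open>By definition of \<open>ero_edge\<close>, such a \<open>j\<close> has
    \<open>vset H j \<subseteq> ero_vert H J\<close>.\<close>
  then have "vset H j \<subseteq> vert_erosion H X" if "j \<in> edge_erosion H J" for j
    using that by (auto simp: edge_erosion_def ero_edge_def)
  moreover have "vert_erosion H X \<subseteq> verts H"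
    by (simp add: vert_erosion_def ero_vert_def)
  moreover have "edge_erosion H J \<subseteq> edge_index H"
    by (auto simp: edge_erosion_def ero_edge_def)
  ultimately show "hyp_erosion H Z \<in> subhypergraphs H"
    by (simp add: hyp_erosion_def subhypergraphs_def)
qed

text \<open>Membership in \<open>dil_vert H J\<close> or \<open>dil_edge H X\<close> asks for the
  existence of a suitable element of the argument. Such conditions commute with all unions, the
  empty one included, and so do the composites.\<close>

lemma hyp_dilation_subhyp_Sup:
  "hyp_dilation H (subhyp_Sup A) = subhyp_Sup (hyp_dilation H ` A)"
  by (auto simp: hyp_dilation_def vert_dilation_def edge_dilation_def dil_vert_def
      dil_edge_def subhyp_Sup_def)

text \<open>A vertex survives iff it avoids every hyperedge not contained in \<open>X\<close>; this
  is the contrapositive. Now \<open>X\<close> occurs only in universally quantified inclusions,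
  which commute with intersections.\<close>

lemma vert_erosion_eq:
  "vert_erosion H X = {v \<in> verts H. \<forall>i\<in>edge_index H. v \<in> vset H i \<longrightarrow> vset H i \<subseteq> X}"
  by (auto simp: vert_erosion_def ero_vert_def ero_edge_def)

text \<open>Again by contraposition: \<open>vset H i\<close> must avoid every hyperedge outside
  \<open>J\<close>. It must also lie in \<open>verts H\<close>, which \<open>is_hypergraph H\<close>
  supplies. A hyperedge with empty vertex set survives for every \<open>J\<close>.\<close>

lemma edge_erosion_eq:
  assumes "is_hypergraph H"
  shows "edge_erosion H J =
    {i \<in> edge_index H. \<forall>k\<in>edge_index H. vset H i \<inter> vset H k \<noteq> {} \<longrightarrow> k \<in> J}"
  using assms
  unfolding edge_erosion_def ero_vert_def ero_edge_def is_hypergraph_def o_def by blast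

lemma hyp_erosion_subhyp_Inf:
  assumes "is_hypergraph H"
  shows "hyp_erosion H (subhyp_Inf H A) = subhyp_Inf H (hyp_erosion H ` A)"
proof -
  \<comment> \<open>The extra condition \<open>vset H i \<subseteq> verts H\<close> on the left
    holds in a hypergraph; for empty \<open>A\<close> both sides equal
    \<open>verts H\<close>.\<close>
  have "vert_erosion H (verts H \<inter> \<Inter>(fst ` A)) =
      verts H \<inter> (\<Inter>X\<in>A. vert_erosion H (fst X))"
    using assms unfolding vert_erosion_eq is_hypergraph_def by blast
  moreover have "edge_erosion H (edge_index H \<inter> \<Inter>(snd ` A)) =
      edge_index H \<inter> (\<Inter>X\<in>A. edge_erosion H (snd X))"
    by (auto simp: edge_erosion_eq[OF assms])
  ultimately show ?thesis
    by (simp add: hyp_erosion_def subhyp_Inf_def image_image)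
qed

theorem theorem1:
  fixes H :: "('v, 'i) hypergraph"
  assumes "is_hypergraph H"
  shows "complete_lattice (subhyp_order H)
    \<and> hyp_dilation H \<in> subhypergraphs H \<rightarrow> subhypergraphs H
    \<and> hyp_erosion H \<in> subhypergraphs H \<rightarrow> subhypergraphs H
    \<and> is_dilation (subhyp_order H) (hyp_dilation H)
    \<and> is_erosion (subhyp_order H) (hyp_erosion H)"
proof -
  note dil = hyp_dilation_subhypergraphs[OF assms]
  note ero = hyp_erosion_subhypergraphs[of H]
  have "is_dilation (subhyp_order H) (hyp_dilation H)"
    unfolding is_dilation_def carrier_subhyp_order
  proof (intro conjI allI impI dil)
    fix A assume A: "A \<subseteq> subhypergraphs H"
    \<comment> \<open>Needed to apply \<open>sup_subhyp_order\<close> to the image family as well as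
      to \<open>A\<close>.\<close>
    then have "hyp_dilation H ` A \<subseteq> subhypergraphs H"
      using dil by blast
    with A show "hyp_dilation H (\<Squnion>\<^bsub>subhyp_order H\<^esub> A) =
        \<Squnion>\<^bsub>subhyp_order H\<^esub> (hyp_dilation H ` A)"
      by (simp add: sup_subhyp_order hyp_dilation_subhyp_Sup)
  qed
  moreover have "is_erosion (subhyp_order H) (hyp_erosion H)"
    unfolding is_erosion_def carrier_subhyp_order
  proof (intro conjI allI impI ero)
    fix A assume A: "A \<subseteq> subhypergraphs H"
    then have "hyp_erosion H ` A \<subseteq> subhypergraphs H"
      using ero by blast
    with A show "hyp_erosion H (\<Sqinter>\<^bsub>subhyp_order H\<^esub> A) =
        \<Sqinter>\<^bsub>subhyp_order H\<^esub> (hyp_erosion H ` A)"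
      by (simp add: inf_subhyp_order[OF assms] hyp_erosion_subhyp_Inf[OF assms])
  qed
  ultimately show ?thesis
    using complete_lattice_subhyp_order[OF assms] dil ero by blast
qed

end
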